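(* Let $(\Xi,\rho,\theta,\Sigma)$ be a continuous groupoid action. Every periodic point $\sigma\in\Sigma$ has a compact orbit.
   Context: All topological spaces are Hausdorff. A groupoid $\Xi$ is a small category in which all arrows are invertible; $X=\Xi^{(0)}$ is its unit space, $d,r:\Xi\to X$ are the source and range maps, and $\xi\eta$ is defined iff $d(\xi)=r(\eta)$. A topological groupoid is a groupoid with a (Hausdorff) topology making inversion and multiplication continuous (composable pairs carry the topology induced from $\Xi\times\Xi$); $X$ has the subspace topology. For $x\in X$, $\Xi_x=d^{-1}(\{x\})$. For $\mathsf A,\mathsf B\subset\Xi$, $\mathsf A\mathsf B=\{\xi\eta:\xi\in\mathsf A,\ \eta\in\mathsf B,\ d(\xi)=r(\eta)\}$. A continuous groupoid action $(\Xi,\rho,\theta,\Sigma)$ consists of a topological groupoid $\Xi$, a Hausdorff space $\Sigma$, a continuous surjection $\rho:\Sigma\to X$ (the anchor) and a continuous map $\theta:\{(\xi,\sigma)\in\Xi\times\Sigma: d(\xi)=\rho(\sigma)\}\to\Sigma$, $\theta_\xi(\sigma)=\xi\bullet\sigma$, with $\rho(\sigma)\bullet\sigma=\sigma$ and: if $d(\xi)=r(\eta)$ and $d(\eta)=\rho(\sigma)$ then $d(\xi)=\rho(\eta\bullet\sigma)$ and $(\xi\eta)\bullet\sigma=\xi\bullet(\eta\bullet\sigma)$. The orbit of $\sigma$ is $\mathfrak O_\sigma=\{\xi\bullet\sigma:\xi\in\Xi_{\rho(\sigma)}\}$; its stabilizer is $\widetilde\Xi_\sigma^\sigma=\{\xi\in\Xi_{\rho(\sigma)}:\xi\bullet\sigma=\sigma\}$.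 A subset $\mathsf A\subset\Xi_x$ is syndetic (in $\Xi_x$) if $\mathsf K\mathsf A=\Xi_x$ for some compact $\mathsf K\subset\Xi$. The point $\sigma$ is periodic if $\widetilde\Xi_\sigma^\sigma$ is syndetic in $\Xi_{\rho(\sigma)}$. *)

theory Defs
  imports "HOL-Analysis.Analysis"
begin

text \<open>
  A groupoid is represented by its arrows, which form the carrier of the topology \<open>gtop\<close>;
  objects are identified with their identity arrows. All operations are total HOL functions
  whose values are only meaningful on arrows, resp. on composable pairs of arrows.
\<close>

record 'g top_groupoid =
  gtop :: "'g topology"
  gunits :: "'g set"
  gsrc :: "'g \<Rightarrow> 'g"
  grng :: "'g \<Rightarrow> 'g"
  gmult :: "'g \<Rightarrow> 'g \<Rightarrow> 'g"
  ginv :: "'g \<Rightarrow> 'g"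

definition garrows :: "'g top_groupoid \<Rightarrow> 'g set" where
  "garrows \<Xi> = topspace (gtop \<Xi>)"

locale groupoid =
  fixes \<Xi> :: "'g top_groupoid"
  assumes units_subset: "gunits \<Xi> \<subseteq> garrows \<Xi>"
    and src_unit: "\<xi> \<in> garrows \<Xi> \<Longrightarrow> gsrc \<Xi> \<xi> \<in> gunits \<Xi>"
    and rng_unit: "\<xi> \<in> garrows \<Xi> \<Longrightarrow> grng \<Xi> \<xi> \<in> gunits \<Xi>"
    and src_of_unit: "x \<in> gunits \<Xi> \<Longrightarrow> gsrc \<Xi> x = x"
    and rng_of_unit: "x \<in> gunits \<Xi> \<Longrightarrow> grng \<Xi> x = x"
    and mult_closed: "\<lbrakk>\<xi> \<in> garrows \<Xi>; \<eta> \<in> garrows \<Xi>; gsrc \<Xi> \<xi> = grng \<Xi> \<eta>\<rbrakk>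
      \<Longrightarrow> gmult \<Xi> \<xi> \<eta> \<in> garrows \<Xi>"
    and src_mult: "\<lbrakk>\<xi> \<in> garrows \<Xi>; \<eta> \<in> garrows \<Xi>; gsrc \<Xi> \<xi> = grng \<Xi> \<eta>\<rbrakk>
      \<Longrightarrow> gsrc \<Xi> (gmult \<Xi> \<xi> \<eta>) = gsrc \<Xi> \<eta>"
    and rng_mult: "\<lbrakk>\<xi> \<in> garrows \<Xi>; \<eta> \<in> garrows \<Xi>; gsrc \<Xi> \<xi> = grng \<Xi> \<eta>\<rbrakk>
      \<Longrightarrow> grng \<Xi> (gmult \<Xi> \<xi> \<eta>) = grng \<Xi> \<xi>"
    and mult_assoc: "\<lbrakk>\<xi> \<in> garrows \<Xi>; \<eta> \<in> garrows \<Xi>; \<zeta> \<in> garrows \<Xi>;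
        gsrc \<Xi> \<xi> = grng \<Xi> \<eta>; gsrc \<Xi> \<eta> = grng \<Xi> \<zeta>\<rbrakk>
      \<Longrightarrow> gmult \<Xi> (gmult \<Xi> \<xi> \<eta>) \<zeta> = gmult \<Xi> \<xi> (gmult \<Xi> \<eta> \<zeta>)"
    and mult_src: "\<xi> \<in> garrows \<Xi> \<Longrightarrow> gmult \<Xi> \<xi> (gsrc \<Xi> \<xi>) = \<xi>"
    and rng_mult_left: "\<xi> \<in> garrows \<Xi> \<Longrightarrow> gmult \<Xi> (grng \<Xi> \<xi>) \<xi> = \<xi>"
    and inv_closed: "\<xi> \<in> garrows \<Xi> \<Longrightarrow> ginv \<Xi> \<xi> \<in> garrows \<Xi>"
    and src_inv: "\<xi> \<in> garrows \<Xi> \<Longrightarrow> gsrc \<Xi> (ginv \<Xi> \<xi>) = grng \<Xi> \<xi>"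
    and rng_inv: "\<xi> \<in> garrows \<Xi> \<Longrightarrow> grng \<Xi> (ginv \<Xi> \<xi>) = gsrc \<Xi> \<xi>"
    and mult_inv_right: "\<xi> \<in> garrows \<Xi> \<Longrightarrow> gmult \<Xi> \<xi> (ginv \<Xi> \<xi>) = grng \<Xi> \<xi>"
    and mult_inv_left: "\<xi> \<in> garrows \<Xi> \<Longrightarrow> gmult \<Xi> (ginv \<Xi> \<xi>) \<xi> = gsrc \<Xi> \<xi>"

locale topological_groupoid = groupoid \<Xi>
  for \<Xi> :: "'g top_groupoid" +
  assumes Hausdorff_arrows: "Hausdorff_space (gtop \<Xi>)"
    and continuous_inv: "continuous_map (gtop \<Xi>) (gtop \<Xi>) (ginv \<Xi>)"
    and continuous_mult:
      "continuous_map
         (subtopology (prod_topology (gtop \<Xi>) (gtop \<Xi>)) {(\<xi>, \<eta>). gsrc \<Xi> \<xi> = grng \<Xi> \<eta>})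
         (gtop \<Xi>) (\<lambda>(\<xi>, \<eta>). gmult \<Xi> \<xi> \<eta>)"

definition unit_space :: "'g top_groupoid \<Rightarrow> 'g topology" where
  "unit_space \<Xi> = subtopology (gtop \<Xi>) (gunits \<Xi>)"

locale continuous_groupoid_action = topological_groupoid \<Xi>
  for \<Xi> :: "'g top_groupoid"
    and \<rho> :: "'s \<Rightarrow> 'g"
    and \<theta> :: "'g \<Rightarrow> 's \<Rightarrow> 's"
    and \<Sigma> :: "'s topology" +
  assumes Hausdorff_points: "Hausdorff_space \<Sigma>"
    and continuous_anchor: "continuous_map \<Sigma> (unit_space \<Xi>) \<rho>"
    and anchor_surj: "\<rho> ` topspace \<Sigma> = gunits \<Xi>"
    and continuous_act:
      "continuous_map
         (subtopology (prod_topology (gtop \<Xi>) \<Sigma>) {(\<xi>, \<sigma>). gsrc \<Xi> \<xi> = \<rho> \<sigma>})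
         \<Sigma> (\<lambda>(\<xi>, \<sigma>). \<theta> \<xi> \<sigma>)"
    and unit_act: "\<sigma> \<in> topspace \<Sigma> \<Longrightarrow> \<theta> (\<rho> \<sigma>) \<sigma> = \<sigma>"
    and anchor_act: "\<lbrakk>\<xi> \<in> garrows \<Xi>; \<eta> \<in> garrows \<Xi>; \<sigma> \<in> topspace \<Sigma>;
        gsrc \<Xi> \<xi> = grng \<Xi> \<eta>; gsrc \<Xi> \<eta> = \<rho> \<sigma>\<rbrakk> \<Longrightarrow> gsrc \<Xi> \<xi> = \<rho> (\<theta> \<eta> \<sigma>)"
    and mult_act: "\<lbrakk>\<xi> \<in> garrows \<Xi>; \<eta> \<in> garrows \<Xi>; \<sigma> \<in> topspace \<Sigma>;
        gsrc \<Xi> \<xi> = grng \<Xi> \<eta>; gsrc \<Xi> \<eta> = \<rho> \<sigma>\<rbrakk>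
      \<Longrightarrow> \<theta> (gmult \<Xi> \<xi> \<eta>) \<sigma> = \<theta> \<xi> (\<theta> \<eta> \<sigma>)"

definition src_fiber :: "'g top_groupoid \<Rightarrow> 'g \<Rightarrow> 'g set" where
  "src_fiber \<Xi> x = {\<xi> \<in> garrows \<Xi>. gsrc \<Xi> \<xi> = x}"

definition gset_mult :: "'g top_groupoid \<Rightarrow> 'g set \<Rightarrow> 'g set \<Rightarrow> 'g set" where
  "gset_mult \<Xi> A B = {gmult \<Xi> \<xi> \<eta> |\<xi> \<eta>. \<xi> \<in> A \<and> \<eta> \<in> B \<and> gsrc \<Xi> \<xi> = grng \<Xi> \<eta>}"

definition orbit :: "'g top_groupoid \<Rightarrow> ('s \<Rightarrow> 'g) \<Rightarrow> ('g \<Rightarrow> 's \<Rightarrow> 's) \<Rightarrow> 's \<Rightarrow> 's set"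
  where "orbit \<Xi> \<rho> \<theta> \<sigma> = {\<theta> \<xi> \<sigma> |\<xi>. \<xi> \<in> src_fiber \<Xi> (\<rho> \<sigma>)}"

definition stabilizer ::
    "'g top_groupoid \<Rightarrow> ('s \<Rightarrow> 'g) \<Rightarrow> ('g \<Rightarrow> 's \<Rightarrow> 's) \<Rightarrow> 's \<Rightarrow> 'g set"
  where "stabilizer \<Xi> \<rho> \<theta> \<sigma> = {\<xi> \<in> src_fiber \<Xi> (\<rho> \<sigma>). \<theta> \<xi> \<sigma> = \<sigma>}"

definition syndetic_in :: "'g top_groupoid \<Rightarrow> 'g \<Rightarrow> 'g set \<Rightarrow> bool" where
  "syndetic_in \<Xi> x A \<longleftrightarrow>
     A \<subseteq> src_fiber \<Xi> x \<and> (\<exists>K. compactin (gtop \<Xi>) K \<and> gset_mult \<Xi> K A = src_fiber \<Xi> x)"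

definition periodic_point ::
    "'g top_groupoid \<Rightarrow> ('s \<Rightarrow> 'g) \<Rightarrow> ('g \<Rightarrow> 's \<Rightarrow> 's) \<Rightarrow> 's \<Rightarrow> bool"
  where "periodic_point \<Xi> \<rho> \<theta> \<sigma> \<longleftrightarrow> syndetic_in \<Xi> (\<rho> \<sigma>) (stabilizer \<Xi> \<rho> \<theta> \<sigma>)"

end

theory Submission
  imports Defs
begin

text \<open>
  Let \<open>x = \<rho> \<sigma>\<close> and let \<open>K\<close> be a compact set of arrows whose product with the stabilizer of
  \<open>\<sigma>\<close> is \<open>\<Xi>\<^sub>x\<close>. A stabilizing arrow \<open>\<eta>\<close> moves \<open>\<sigma>\<close> to itself and hence ends at \<open>x\<close>, where it
  also starts. So in a product \<open>\<xi> \<eta>\<close> with \<open>\<xi> \<in> K\<close> the factor \<open>\<xi>\<close> lies in \<open>K \<inter> \<Xi>\<^sub>x\<close>, and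
  \<open>\<xi> \<eta>\<close> moves \<open>\<sigma>\<close> to the same point as \<open>\<xi>\<close> does. The orbit is therefore already the image of
  \<open>K \<inter> \<Xi>\<^sub>x\<close> under \<open>\<xi> \<mapsto> \<xi> \<bullet> \<sigma>\<close> (lemma \<open>orbit_eq_image_of_syndetic_factor\<close>).

  The arrow set \<open>K\<close> need not be contained in \<open>\<Xi>\<^sub>x\<close>, so compactness of \<open>K \<inter> \<Xi>\<^sub>x\<close> uses that the
  source fibre is closed (lemma \<open>closedin_src_fiber\<close>). The map \<open>\<xi> \<mapsto> \<xi> \<bullet> \<sigma>\<close> is continuous on
  \<open>\<Xi>\<^sub>x\<close>, and so it carries this compact set to a compact set.
\<close>

context topological_groupoid
begin

text \<open>
  The formula \<open>d(\<xi>) = \<xi>\<inverse> \<xi>\<close> writes the source map in terms of the two continuous operations.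
\<close>
lemma continuous_map_src: "continuous_map (gtop \<Xi>) (gtop \<Xi>) (gsrc \<Xi>)"
proof -
  have "continuous_map (gtop \<Xi>)
      (subtopology (prod_topology (gtop \<Xi>) (gtop \<Xi>)) {(\<xi>, \<eta>). gsrc \<Xi> \<xi> = grng \<Xi> \<eta>})
      (\<lambda>\<xi>. (ginv \<Xi> \<xi>, \<xi>))"
    using continuous_inv src_inv
    by (auto simp: continuous_map_in_subtopology continuous_map_pairwise o_def garrows_def)
  from continuous_map_compose[OF this continuous_mult]
  have "continuous_map (gtop \<Xi>) (gtop \<Xi>) (\<lambda>\<xi>. gmult \<Xi> (ginv \<Xi> \<xi>) \<xi>)"
    by (simp add: o_def)
  then show ?thesis
    by (rule continuous_map_eq) (simp add: mult_inv_left garrows_def)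
qed

text \<open>The fibre is the preimage of a point, and points of a Hausdorff space are closed.\<close>
lemma closedin_src_fiber:
  assumes "x \<in> garrows \<Xi>"
  shows "closedin (gtop \<Xi>) (src_fiber \<Xi> x)"
proof -
  have "closedin (gtop \<Xi>) {x}"
    using assms Hausdorff_arrows by (simp add: closedin_Hausdorff_singleton garrows_def)
  from closedin_continuous_map_preimage[OF continuous_map_src this]
  show ?thesis
    by (simp add: src_fiber_def garrows_def)
qed

end

context continuous_groupoid_action
begin

lemma anchor_arrow:
  assumes "\<sigma> \<in> topspace \<Sigma>"
  shows "\<rho> \<sigma> \<in> garrows \<Xi>"
  using assms anchor_surj units_subset by blast

lemma continuous_map_orbit_map:
  assumes "\<sigma> \<in> topspace \<Sigma>"
  shows "continuous_map (subtopology (gtop \<Xi>) (src_fiber \<Xi> (\<rho> \<sigma>))) \<Sigma> (\<lambda>\<xi>. \<theta> \<xi> \<sigma>)"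
proof -
  have "continuous_map (subtopology (gtop \<Xi>) (src_fiber \<Xi> (\<rho> \<sigma>)))
      (subtopology (prod_topology (gtop \<Xi>) \<Sigma>) {(\<xi>, \<sigma>). gsrc \<Xi> \<xi> = \<rho> \<sigma>}) (\<lambda>\<xi>. (\<xi>, \<sigma>))"
    using assms
    by (auto simp: continuous_map_in_subtopology continuous_map_pairwise o_def src_fiber_def
        continuous_map_from_subtopology)
  from continuous_map_compose[OF this continuous_act] show ?thesis
    by (simp add: o_def)
qed

text \<open>
  The axioms only say which arrows can be applied to \<open>\<eta> \<bullet> \<sigma>\<close>. Testing this with the unit at
  the range of \<open>\<eta>\<close> determines the anchor.
\<close>
lemma anchor_act_eq_rng:
  assumes "\<eta> \<in> src_fiber \<Xi> (\<rho> \<sigma>)" "\<sigma> \<in> topspace \<Sigma>"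
  shows "\<rho> (\<theta> \<eta> \<sigma>) = grng \<Xi> \<eta>"
proof -
  have \<eta>: "\<eta> \<in> garrows \<Xi>" "gsrc \<Xi> \<eta> = \<rho> \<sigma>"
    using assms(1) by (auto simp: src_fiber_def)
  then have "grng \<Xi> \<eta> \<in> gunits \<Xi>"
    by (simp add: rng_unit)
  then have "grng \<Xi> \<eta> \<in> garrows \<Xi>" "gsrc \<Xi> (grng \<Xi> \<eta>) = grng \<Xi> \<eta>"
    using units_subset by (auto simp: src_of_unit)
  then show ?thesis
    using anchor_act[of "grng \<Xi> \<eta>" \<eta> \<sigma>] \<eta> assms(2) by simp
qed

text \<open>
  Stabilizing arrows start and end at \<open>\<rho> \<sigma>\<close>. This forces the left factor of any product with
  one of them into the source fibre, and cancelling the right factor leaves \<open>\<xi> \<bullet> \<sigma>\<close> unchanged.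
\<close>
lemma orbit_eq_image_of_syndetic_factor:
  assumes \<sigma>: "\<sigma> \<in> topspace \<Sigma>" and K: "K \<subseteq> garrows \<Xi>"
    and cover: "gset_mult \<Xi> K (stabilizer \<Xi> \<rho> \<theta> \<sigma>) = src_fiber \<Xi> (\<rho> \<sigma>)"
  shows "orbit \<Xi> \<rho> \<theta> \<sigma> = (\<lambda>\<xi>. \<theta> \<xi> \<sigma>) ` (src_fiber \<Xi> (\<rho> \<sigma>) \<inter> K)"
proof
  show "orbit \<Xi> \<rho> \<theta> \<sigma> \<subseteq> (\<lambda>\<xi>. \<theta> \<xi> \<sigma>) ` (src_fiber \<Xi> (\<rho> \<sigma>) \<inter> K)"
  proof
    fix \<tau> assume "\<tau> \<in> orbit \<Xi> \<rho> \<theta> \<sigma>"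
    then obtain \<zeta> where \<zeta>: "\<zeta> \<in> src_fiber \<Xi> (\<rho> \<sigma>)" and \<tau>: "\<tau> = \<theta> \<zeta> \<sigma>"
      by (auto simp: orbit_def)
    obtain \<xi> \<eta> where \<xi>: "\<xi> \<in> K" and \<eta>: "\<eta> \<in> stabilizer \<Xi> \<rho> \<theta> \<sigma>"
      and composable: "gsrc \<Xi> \<xi> = grng \<Xi> \<eta>" and \<zeta>_eq: "\<zeta> = gmult \<Xi> \<xi> \<eta>"
      using \<zeta> unfolding cover[symmetric] gset_mult_def by blast
    have \<eta>_fiber: "\<eta> \<in> src_fiber \<Xi> (\<rho> \<sigma>)" and \<eta>_fixes: "\<theta> \<eta> \<sigma> = \<sigma>"
      using \<eta> by (auto simp: stabilizer_def)
    have "grng \<Xi> \<eta> = \<rho> \<sigma>"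
      using anchor_act_eq_rng[OF \<eta>_fiber \<sigma>] \<eta>_fixes by simp
    then have "\<xi> \<in> src_fiber \<Xi> (\<rho> \<sigma>) \<inter> K"
      using \<xi> K composable by (auto simp: src_fiber_def)
    moreover have "\<tau> = \<theta> \<xi> \<sigma>"
      using mult_act[of \<xi> \<eta> \<sigma>] \<xi> K \<eta>_fiber \<sigma> composable
      by (auto simp: \<tau> \<zeta>_eq \<eta>_fixes src_fiber_def)
    ultimately show "\<tau> \<in> (\<lambda>\<xi>. \<theta> \<xi> \<sigma>) ` (src_fiber \<Xi> (\<rho> \<sigma>) \<inter> K)"
      by blast
  qed
next
  show "(\<lambda>\<xi>. \<theta> \<xi> \<sigma>) ` (src_fiber \<Xi> (\<rho> \<sigma>) \<inter> K) \<subseteq> orbit \<Xi> \<rho> \<theta> \<sigma>"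
    by (auto simp: orbit_def)
qed

lemma compactin_orbit_of_periodic:
  assumes \<sigma>: "\<sigma> \<in> topspace \<Sigma>" and "periodic_point \<Xi> \<rho> \<theta> \<sigma>"
  shows "compactin \<Sigma> (orbit \<Xi> \<rho> \<theta> \<sigma>)"
proof -
  obtain K where K: "compactin (gtop \<Xi>) K"
    and cover: "gset_mult \<Xi> K (stabilizer \<Xi> \<rho> \<theta> \<sigma>) = src_fiber \<Xi> (\<rho> \<sigma>)"
    using assms(2) by (auto simp: periodic_point_def syndetic_in_def)
  have "compactin (gtop \<Xi>) (src_fiber \<Xi> (\<rho> \<sigma>) \<inter> K)"
    by (rule closed_Int_compactin[OF closedin_src_fiber[OF anchor_arrow[OF \<sigma>]] K])
  then have "compactin (subtopology (gtop \<Xi>) (src_fiber \<Xi> (\<rho> \<sigma>))) (src_fiber \<Xi> (\<rho> \<sigma>) \<inter> K)"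
    by (simp add: compactin_subtopology)
  from image_compactin[OF this continuous_map_orbit_map[OF \<sigma>]]
  show ?thesis
    using orbit_eq_image_of_syndetic_factor[OF \<sigma> _ cover] compactin_subset_topspace[OF K]
    by (simp add: garrows_def)
qed

end

theorem proposition6p16:
  fixes \<Xi> :: "'g top_groupoid"
    and \<rho> :: "'s \<Rightarrow> 'g"
    and \<theta> :: "'g \<Rightarrow> 's \<Rightarrow> 's"
    and \<Sigma> :: "'s topology"
    and \<sigma> :: 's
  assumes "continuous_groupoid_action \<Xi> \<rho> \<theta> \<Sigma>"
    and "\<sigma> \<in> topspace \<Sigma>"
    and "periodic_point \<Xi> \<rho> \<theta> \<sigma>"
  shows "compactin \<Sigma> (orbit \<Xi> \<rho> \<theta> \<sigma>)"
  using assms by (rule continuous_groupoid_action.compactin_orbit_of_periodic)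

end
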